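(* Let $D=(\mathcal{P},\mathcal{B})$ be a symmetric $(v,k,\lambda)$-design. Let $X\subseteq \mathcal{P}$ and $Y\subseteq \mathcal{B}$ with $|X|=|Y|$, such that no point of $X$ is incident with a block of $Y$. Then the incidence graph of $D$ induced on $(\mathcal{P}\setminus X)\cup(\mathcal{B}\setminus Y)$ has a perfect matching, i.e. there is a bijection $\sigma:\mathcal{P}\setminus X\to \mathcal{B}\setminus Y$ such that $p\in\sigma(p)$ for every $p\in\mathcal{P}\setminus X$.
   Context: A symmetric $(v,k,\lambda)$-design $D=(\mathcal{P},\mathcal{B})$ consists of a set $\mathcal{P}$ of $v$ points and a collection $\mathcal{B}$ of $v$ blocks (subsets of $\mathcal{P}$), each block containing exactly $k$ points, such that every pair of distinct points is contained in exactly $\lambda$ blocks. The incidence graph of $D$ is the bipartite graph with vertex set $\mathcal{P}\cup\mathcal{B}$ in which a point $p$ and a block $C$ are adjacent iff $p\in C$. A pair $(X,Y)$ with $X\subseteq\mathcal{P}$, $Y\subseteq\mathcal{B}$ is called equinumerous if $|X|=|Y|$ and incidence-free if no point of $X$ lies in a block of $Y$.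
   Formalization: The design is assumed to have k > 0 and λ > 0; without this the claim fails, e.g. for two points a, b with blocks {a}, {b} (λ = 0), X = {a} and Y = {{b}}. *)

theory Defs
  imports Main
begin

(* The conditions 0 < k and 0 < l are the nondegeneracy part of the notion of a
   symmetric (v,k,l)-design, in a weak form (the usual 0 < l < k < v implies it, and
   neither v \<ge> 2 nor k < v is required).  They exclude in particular the systems
   v = 1, blocks {{}}, and v = 2, blocks {{a}, {b}}. *)
definition symmetric_design ::
    "'a set \<Rightarrow> 'a set set \<Rightarrow> nat \<Rightarrow> nat \<Rightarrow> nat \<Rightarrow> bool" where
  "symmetric_design P B v k l \<longleftrightarrow>
     0 < k \<and> 0 < l \<and>
     finite P \<and> card P = v \<and>
     B \<subseteq> Pow P \<and> card B = v \<and>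
     (\<forall>C\<in>B. card C = k) \<and>
     (\<forall>p\<in>P. \<forall>q\<in>P. p \<noteq> q \<longrightarrow> card {C \<in> B. p \<in> C \<and> q \<in> C} = l)"

definition equinumerous :: "'a set \<Rightarrow> 'a set set \<Rightarrow> bool" where
  "equinumerous X Y \<longleftrightarrow> card X = card Y"

definition incidence_free :: "'a set \<Rightarrow> 'a set set \<Rightarrow> bool" where
  "incidence_free X Y \<longleftrightarrow> (\<forall>p\<in>X. \<forall>C\<in>Y. p \<notin> C)"

(* An undirected graph is a pair of a vertex set and a set of two-element edges. *)
type_synonym 'v graph = "'v set \<times> 'v set set"

definition incidence_graph :: "'a set \<Rightarrow> 'a set set \<Rightarrow> ('a + 'a set) graph" where
  "incidence_graph P B = (P <+> B, {{Inl p, Inr C} | p C. p \<in> P \<and> C \<in> B \<and> p \<in> C})"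

definition induced_subgraph :: "'v graph \<Rightarrow> 'v set \<Rightarrow> 'v graph" where
  "induced_subgraph G W = (fst G \<inter> W, {e \<in> snd G. e \<subseteq> W})"

definition perfect_matching :: "'v graph \<Rightarrow> 'v set set \<Rightarrow> bool" where
  "perfect_matching G M \<longleftrightarrow> M \<subseteq> snd G \<and> (\<forall>x\<in>fst G. \<exists>!e. e \<in> M \<and> x \<in> e)"

end

theory Submission
  imports Defs
begin

text \<open>By Hall's theorem it suffices to rule out a set \<open>S\<close> of points outside \<open>X\<close> with fewer than
  \<open>|S|\<close> neighbours outside \<open>Y\<close>. Let \<open>T\<close> be the set of blocks outside \<open>Y\<close> that miss \<open>S\<close>, and write
  \<open>s, t, x\<close> for the sizes of \<open>S, T, X\<close>, so that \<open>s + t + x > v\<close>. A variance argument gives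
  \<open>l s t \<le> (k - l) (v - s - t) \<le> (k - l) (x - 1)\<close>, which forces \<open>x\<close> to be large. On the other
  hand each of the \<open>l x s\<close> incidences of a block with a pair in \<open>S \<times> X\<close> uses one of the fewer than
  \<open>s\<close> blocks outside \<open>Y \<union> T\<close>. Such a block \<open>C\<close> covers \<open>|C \<inter> S| |C \<inter> X|\<close> pairs, where
  \<open>|C \<inter> S| + |C \<inter> X| \<le> k\<close>, so \<open>l x < k\<^sup>2 / 4\<close>, and even \<open>l x \<le> (s - 1) (k - s)\<close> if \<open>2 s \<le> k\<close>.
  Together with the dual statement for \<open>T\<close> this contradicts the lower bound on \<open>x\<close>.\<close>

section \<open>Hall's marriage theorem\<close>

text \<open>Induction on \<open>card A\<close>. If some nonempty proper \<open>J\<close> is tight,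
  \<open>J\<close> and \<open>A - J\<close> are matched separately, the latter after removing the
  neighbours of \<open>J\<close>. If none is tight, any single pair can be fixed, since every
  nonempty proper subset has a neighbour to spare.\<close>

lemma hall_marriage:
  fixes N :: "'a \<Rightarrow> 'b set"
  assumes "finite A" and "\<And>a. a \<in> A \<Longrightarrow> finite (N a)"
    and "\<And>J. J \<subseteq> A \<Longrightarrow> card J \<le> card (\<Union>(N ` J))"
  shows "\<exists>f. inj_on f A \<and> (\<forall>a\<in>A. f a \<in> N a)"
  using assms
proof (induction "card A" arbitrary: A N rule: less_induct)
  case less
  note finA = less.prems(1) and finN = less.prems(2) and hall = less.prems(3)
  have finU: "finite (\<Union>(N ` J))" if "J \<subseteq> A" for J
    using that finA finN by (meson finite_UN_I finite_subset subsetD)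
  show ?case
  proof (cases "\<exists>J. J \<subset> A \<and> J \<noteq> {} \<and> card J = card (\<Union>(N ` J))")
    case True
    then obtain J where J: "J \<subset> A" "J \<noteq> {}" "card J = card (\<Union>(N ` J))"
      by blast
    define R where "R = \<Union>(N ` J)"
    have finJ: "finite J" and finR: "finite R"
      using J finA finU[of J] by (auto simp: R_def intro: finite_subset)
    have "card J < card A"
      using finA J(1) by (rule psubset_card_mono)
    then obtain f where f: "inj_on f J" "\<forall>a\<in>J. f a \<in> N a"
      using less.hyps[of J N] J finJ finN hall by (metis psubsetE subset_trans subsetD)
    have "card (A - J) < card A"
      using J finA by (intro psubset_card_mono) auto
    moreover have "card K \<le> card (\<Union>((\<lambda>a. N a - R) ` K))" if K: "K \<subseteq> A - J" for K
    proof -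
      have finK: "finite K" using K finA by (meson finite_Diff finite_subset)
      have "card K + card J = card (K \<union> J)"
        using K finK finJ by (subst card_Un_disjoint) auto
      also have "\<dots> \<le> card (\<Union>(N ` (K \<union> J)))"
        using hall K J by (metis Diff_subset Un_least psubsetE subset_trans)
      also have "\<Union>(N ` (K \<union> J)) = \<Union>((\<lambda>a. N a - R) ` K) \<union> R"
        by (auto simp: R_def)
      also have "card \<dots> \<le> card (\<Union>((\<lambda>a. N a - R) ` K)) + card R"
        by (rule card_Un_le)
      finally show ?thesis using J(3) by (simp add: R_def)
    qed
    ultimately obtain g where g: "inj_on g (A - J)" "\<forall>a\<in>A - J. g a \<in> N a - R"
      using less.hyps[of "A - J" "\<lambda>a. N a - R"] finA finN by auto
    define h where "h a = (if a \<in> J then f a else g a)" for a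
    have "inj_on h A"
      using f g unfolding inj_on_def h_def R_def by (smt (verit) DiffD2 DiffI UN_I)
    moreover have "\<forall>a\<in>A. h a \<in> N a"
      using f g by (auto simp: h_def)
    ultimately show ?thesis by blast
  next
    case False
    show ?thesis
    proof (cases "A = {}")
      case True
      then show ?thesis by simp
    next
      case nonempty: False
      then obtain a where a: "a \<in> A" by blast
      have "N a \<noteq> {}" using hall[of "{a}"] a by auto
      then obtain b where b: "b \<in> N a" by blast
      have "card (A - {a}) < card A"
        using finA a by (rule card_Diff1_less)
      moreover have "card K \<le> card (\<Union>((\<lambda>c. N c - {b}) ` K))" if K: "K \<subseteq> A - {a}" for K
      proof (cases "K = {}")
        case True
        then show ?thesis by simp
      next
        case ne: False
        have sub: "K \<subset> A" using K a by auto
        then have "card K < card (\<Union>(N ` K))"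
          using False ne hall[of K] by (meson nat_less_le psubsetE)
        moreover have "\<Union>((\<lambda>c. N c - {b}) ` K) = \<Union>(N ` K) - {b}" by auto
        moreover have "card (\<Union>(N ` K)) - 1 \<le> card (\<Union>(N ` K) - {b})"
          using finU[of K] sub by (cases "b \<in> \<Union>(N ` K)") auto
        ultimately show ?thesis by simp
      qed
      ultimately obtain g where g: "inj_on g (A - {a})" "\<forall>c\<in>A - {a}. g c \<in> N c - {b}"
        using less.hyps[of "A - {a}" "\<lambda>c. N c - {b}"] finA finN by auto
      have "inj_on (g(a := b)) A"
        using g unfolding inj_on_def by (smt (verit) DiffE DiffI fun_upd_apply insertI1 singletonD)
      moreover have "\<forall>c\<in>A. (g(a := b)) c \<in> N c"
        using g b by auto
      ultimately show ?thesis by blast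
    qed
  qed
qed

section \<open>Symmetric incidence structures\<close>

text \<open>Blocks are abstract objects with an incidence relation, not sets of points, so that
  points and blocks can be exchanged and each bound is available in dual form.\<close>

locale symmetric_incidence =
  fixes P :: "'a set" and B :: "'b set" and I :: "'a \<Rightarrow> 'b \<Rightarrow> bool" and k l :: nat
  assumes finite_points: "finite P" and finite_blocks: "finite B"
    and card_blocks: "card B = card P"
    and k_pos: "0 < k" and l_pos: "0 < l"
    and block_size: "C \<in> B \<Longrightarrow> card {p \<in> P. I p C} = k"
    and pair_degree: "\<lbrakk>p \<in> P; q \<in> P; p \<noteq> q\<rbrakk> \<Longrightarrow> card {C \<in> B. I p C \<and> I q C} = l"
begin

section \<open>Double counting of incidences\<close>

definition deg :: "'a set \<Rightarrow> 'b \<Rightarrow> int" where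
  "deg S C = (\<Sum>p\<in>S. of_bool (I p C))"

lemma deg_eq_card: "finite S \<Longrightarrow> deg S C = int (card {p \<in> S. I p C})"
  by (simp add: deg_def of_bool_def sum.If_cases Int_def)

lemma deg_points: "C \<in> B \<Longrightarrow> deg P C = int k"
  by (simp add: deg_eq_card finite_points block_size)

lemma deg_nonneg: "0 \<le> deg S C"
  by (simp add: deg_def sum_nonneg)

lemma deg_le_card: "deg S C \<le> int (card S)"
  unfolding deg_def using sum_bounded_above[of S "\<lambda>p. of_bool (I p C)" "1::int"] by simp

lemma deg_mono: "S \<subseteq> T \<Longrightarrow> finite T \<Longrightarrow> deg S C \<le> deg T C"
  unfolding deg_def by (rule sum_mono2) auto

lemma deg_disjoint_le:
  assumes "S \<subseteq> P" "X \<subseteq> P" "S \<inter> X = {}" "C \<in> B"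
  shows "deg S C + deg X C \<le> int k"
proof -
  have "deg S C + deg X C = deg (S \<union> X) C"
    unfolding deg_def using assms finite_points
    by (intro sum.union_disjoint[symmetric]) (auto intro: finite_subset)
  also have "\<dots> \<le> deg P C"
    using assms finite_points by (intro deg_mono) auto
  finally show ?thesis using assms deg_points by simp
qed

lemma pair_degree_sum:
  assumes "p \<in> P" "q \<in> P" "p \<noteq> q"
  shows "(\<Sum>C\<in>B. of_bool (I p C) * of_bool (I q C)) = int l"
proof -
  have "(\<Sum>C\<in>B. of_bool (I p C) * of_bool (I q C)) = (\<Sum>C\<in>B. of_bool (I p C \<and> I q C) :: int)"
    by (intro sum.cong) auto
  also have "\<dots> = int (card {C \<in> B. I p C \<and> I q C})"
    using finite_blocks by (simp add: of_bool_def sum.If_cases Int_def)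
  finally show ?thesis using assms pair_degree by simp
qed

lemma sum_deg_points: "(\<Sum>C\<in>B. deg P C) = int k * int (card P)"
  by (simp add: deg_points card_blocks)

text \<open>Counts the pairs \<open>(q, C)\<close> with \<open>p\<close> and \<open>q\<close> both
  on \<open>C\<close>, once by blocks and once by points.\<close>

lemma point_degree_mult:
  assumes "p \<in> P"
  shows "(int k - 1) * (\<Sum>C\<in>B. of_bool (I p C)) = int l * (int (card P) - 1)"
proof -
  let ?r = "\<Sum>C\<in>B. of_bool (I p C) :: int"
  have "int k * ?r = (\<Sum>C\<in>B. of_bool (I p C) * deg P C)"
    by (simp add: deg_points sum_distrib_left mult.commute)
  also have "\<dots> = (\<Sum>q\<in>P. \<Sum>C\<in>B. of_bool (I p C) * of_bool (I q C))"
    unfolding deg_def sum_distrib_left by (rule sum.swap)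
  also have "\<dots> = (\<Sum>C\<in>B. of_bool (I p C) * of_bool (I p C))
      + (\<Sum>q\<in>P - {p}. \<Sum>C\<in>B. of_bool (I p C) * of_bool (I q C))"
    using assms finite_points by (rule sum.remove[rotated])
  also have "(\<Sum>C\<in>B. of_bool (I p C) * of_bool (I p C)) = ?r"
    by (intro sum.cong) auto
  also have "(\<Sum>q\<in>P - {p}. \<Sum>C\<in>B. of_bool (I p C) * of_bool (I q C)) = (\<Sum>q\<in>P - {p}. int l)"
    using assms by (intro sum.cong refl pair_degree_sum) auto
  also have "\<dots> = (int (card P) - 1) * int l"
    using card_Suc_Diff1[OF finite_points assms] by simp
  finally show ?thesis by (simp add: algebra_simps)
qed

text \<open>If \<open>k \<noteq> 1\<close>, the preceding identity gives all points the same degree,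
  and the average degree is \<open>k\<close> because there are as many blocks as points. If
  \<open>k = 1\<close>, it forces a single point, as \<open>l > 0\<close>.\<close>

lemma point_degree_sum:
  assumes "p \<in> P"
  shows "(\<Sum>C\<in>B. of_bool (I p C)) = int k"
proof -
  define r where "r q = (\<Sum>C\<in>B. of_bool (I q C) :: int)" for q
  have v: "card P > 0" using assms finite_points card_gt_0_iff by blast
  have tot: "(\<Sum>q\<in>P. r q) = int k * int (card P)"
    unfolding r_def sum_deg_points[symmetric] deg_def by (rule sum.swap)
  have mult: "(int k - 1) * r q = int l * (int (card P) - 1)" if "q \<in> P" for q
    using point_degree_mult[OF that] by (simp add: r_def)
  have "r p = int k"
  proof (cases "k = 1")
    case True
    then have "card P = 1" using mult[OF assms] l_pos by auto
    then have "P = {p}" using assms by (auto simp: card_1_singleton_iff)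
    then show ?thesis using tot by simp
  next
    case False
    have "r q = r p" if "q \<in> P" for q
      using mult[OF that] mult[OF assms] False
      by (metis mult_cancel_left of_nat_1 of_nat_eq_iff right_minus_eq)
    then have "(\<Sum>q\<in>P. r q) = int (card P) * r p" by simp
    then show ?thesis using tot v by simp
  qed
  then show ?thesis by (simp add: r_def)
qed

lemma parameter_equation:
  assumes "P \<noteq> {}"
  shows "int k * (int k - 1) = int l * (int (card P) - 1)"
  using assms point_degree_mult point_degree_sum by (metis ex_in_conv mult.commute)

lemma sum_deg:
  assumes "S \<subseteq> P"
  shows "(\<Sum>C\<in>B. deg S C) = int k * int (card S)"
proof -
  have "(\<Sum>C\<in>B. deg S C) = (\<Sum>p\<in>S. \<Sum>C\<in>B. of_bool (I p C))"
    unfolding deg_def by (rule sum.swap)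
  also have "\<dots> = (\<Sum>p\<in>S. int k)"
    using assms point_degree_sum by (intro sum.cong) auto
  finally show ?thesis by simp
qed

text \<open>Counts triples \<open>(p, q, C)\<close>: a pair with \<open>p = q\<close> lies on
  \<open>k\<close> blocks, any other pair on \<open>l\<close>. In matrix form this is
  \<open>N N^T = (k - l) I + l J\<close>.\<close>

lemma sum_deg_mult:
  assumes "S \<subseteq> P" "X \<subseteq> P"
  shows "(\<Sum>C\<in>B. deg S C * deg X C)
    = (int k - int l) * int (card (S \<inter> X)) + int l * int (card S) * int (card X)"
proof -
  have fin: "finite S" "finite X" using assms finite_points finite_subset by blast+
  have "(\<Sum>C\<in>B. deg S C * deg X C) = (\<Sum>C\<in>B. \<Sum>p\<in>S. \<Sum>q\<in>X. of_bool (I p C) * of_bool (I q C))"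
    by (simp add: deg_def sum_product)
  also have "\<dots> = (\<Sum>p\<in>S. \<Sum>C\<in>B. \<Sum>q\<in>X. of_bool (I p C) * of_bool (I q C))"
    by (rule sum.swap)
  also have "\<dots> = (\<Sum>p\<in>S. \<Sum>q\<in>X. \<Sum>C\<in>B. of_bool (I p C) * of_bool (I q C))"
    by (intro sum.cong refl sum.swap)
  also have "\<dots> = (\<Sum>p\<in>S. \<Sum>q\<in>X. int l + (if q = p then int k - int l else 0))"
  proof (intro sum.cong refl)
    fix p q assume "p \<in> S" "q \<in> X"
    then have pq: "p \<in> P" "q \<in> P" using assms by auto
    show "(\<Sum>C\<in>B. of_bool (I p C) * of_bool (I q C))
        = int l + (if q = p then int k - int l else 0)"
    proof (cases "q = p")
      case True
      have "(\<Sum>C\<in>B. of_bool (I p C) * of_bool (I p C)) = (\<Sum>C\<in>B. of_bool (I p C) :: int)"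
        by (intro sum.cong) auto
      then show ?thesis using True point_degree_sum[OF pq(1)] by simp
    next
      case False
      then show ?thesis using pair_degree_sum[OF pq] by auto
    qed
  qed
  also have "\<dots> = (\<Sum>p\<in>S. int l * int (card X) + (if p \<in> X then int k - int l else 0))"
    using fin by (simp add: sum.distrib sum.delta mult.commute)
  also have "\<dots> = int l * int (card X) * int (card S) + (int k - int l) * int (card (S \<inter> X))"
    using fin by (simp add: sum.distrib sum.If_cases Int_def)
  finally show ?thesis by (simp add: algebra_simps)
qed

section \<open>Duality\<close>

text \<open>With \<open>S\<close> the point set of \<open>C\<close>, the squared deviations of
  \<open>deg S E\<close> from \<open>l\<close> over the blocks \<open>E\<close> other than
  \<open>C\<close> sum to zero, so each intersection has size \<open>l\<close>.\<close>

lemma block_intersection: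
  assumes C: "C \<in> B" and D: "D \<in> B" and ne: "C \<noteq> D"
  shows "card {p \<in> P. I p C \<and> I p D} = l"
proof -
  define S where "S = {p \<in> P. I p C}"
  have S: "S \<subseteq> P" and cardS: "card S = k"
    using block_size C by (auto simp: S_def)
  have finS: "finite S" using S finite_points finite_subset by blast
  have deg_S: "deg S E = int (card {p \<in> P. I p C \<and> I p E})" for E
    using finS by (simp add: deg_eq_card S_def)
  have degC: "deg S C = int k" using deg_S[of C] cardS by (simp add: S_def)
  have "P \<noteq> {}" using S cardS k_pos by auto
  note par = parameter_equation[OF this]
  let ?B = "B - {C}"
  have 1: "(\<Sum>E\<in>?B. deg S E) = int k * int k - int k"
    using sum.remove[OF finite_blocks C, of "deg S"] sum_deg[OF S] degC cardS by simp
  have 2: "(\<Sum>E\<in>?B. deg S E * deg S E) = (int k - int l) * int k + int l * int k * int k - int k * int k"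
    using sum.remove[OF finite_blocks C, of "\<lambda>E. deg S E * deg S E"] sum_deg_mult[OF S S] degC cardS
    by simp
  have 3: "int (card ?B) = int (card P) - 1"
    using card_Suc_Diff1[OF finite_blocks C] card_blocks by simp
  have "(\<Sum>E\<in>?B. (deg S E - int l)\<^sup>2)
      = (\<Sum>E\<in>?B. deg S E * deg S E) - 2 * int l * (\<Sum>E\<in>?B. deg S E) + int l * int l * int (card ?B)"
    by (simp add: power2_eq_square algebra_simps sum.distrib sum_subtractf sum_distrib_left)
  also have "\<dots> = 0"
    unfolding 1 2 3 using par by algebra
  finally have "(deg S D - int l)\<^sup>2 = 0"
    using D ne finite_blocks by (subst (asm) sum_nonneg_eq_0_iff) auto
  then show ?thesis by (simp add: deg_S)
qed

lemma dual: "symmetric_incidence B P (\<lambda>C p. I p C) k l"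
proof
  fix p assume p: "p \<in> P"
  have "int (card {C \<in> B. I p C}) = (\<Sum>C\<in>B. of_bool (I p C))"
    using finite_blocks by (simp add: of_bool_def sum.If_cases Int_def)
  then show "card {C \<in> B. I p C} = k" using point_degree_sum[OF p] by simp
qed (use finite_points finite_blocks card_blocks k_pos l_pos block_intersection in auto)

section \<open>Bounds for incidence-free pairs\<close>

text \<open>Blocks in \<open>T\<close> contribute nothing, so the first two moments of
  \<open>deg S\<close> are already attained on the smaller set \<open>B - T\<close>.\<close>

lemma sum_deg_restrict:
  assumes "T \<subseteq> B" "\<And>p C. \<lbrakk>p \<in> S; C \<in> T\<rbrakk> \<Longrightarrow> \<not> I p C" "\<And>C. deg S C = 0 \<Longrightarrow> f C = 0"
  shows "(\<Sum>C\<in>B - T. f C) = (\<Sum>C\<in>B. f C)"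
  using finite_blocks assms by (intro sum.mono_neutral_left) (auto simp: deg_def)

text \<open>Since every block has \<open>k\<close> points, this already settles the case \<open>X = {}\<close>.\<close>

lemma incidence_free_card_le:
  assumes S: "S \<subseteq> P" and T: "T \<subseteq> B" and free: "\<And>p C. \<lbrakk>p \<in> S; C \<in> T\<rbrakk> \<Longrightarrow> \<not> I p C"
  shows "card S + card T \<le> card P"
proof -
  have "int k * int (card S) = (\<Sum>C\<in>B - T. deg S C)"
    using sum_deg_restrict[OF T free, of S "deg S"] sum_deg[OF S] by simp
  also have "\<dots> \<le> (\<Sum>C\<in>B - T. int k)"
    using deg_mono[OF S finite_points] deg_points by (intro sum_mono) (metis DiffD1)
  also have "\<dots> = int k * int (card (B - T))" by simp
  finally have "card S \<le> card (B - T)" using k_pos by simp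
  then show ?thesis
    using T finite_blocks card_blocks card_mono[OF finite_blocks T]
    by (simp add: card_Diff_subset finite_subset)
qed

text \<open>The variance of \<open>deg S\<close> over the blocks outside \<open>T\<close> is nonnegative. The centre
  \<open>(k - l + l * card S) / k\<close> is the mean in the extremal case; clearing the denominator keeps
  everything in the integers.\<close>

lemma incidence_free_bound:
  assumes S: "S \<subseteq> P" "S \<noteq> {}" and T: "T \<subseteq> B"
    and free: "\<And>p C. \<lbrakk>p \<in> S; C \<in> T\<rbrakk> \<Longrightarrow> \<not> I p C"
  shows "int l * int (card S) * int (card T)
    \<le> (int k - int l) * (int (card P) - int (card S) - int (card T))"
proof -
  define s t v where "s = int (card S)" and "t = int (card T)" and "v = int (card P)"
  define m where "m = int k - int l + int l * s"
  have "card S > 0" using S finite_points by (meson card_gt_0_iff finite_subset)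
  then have s: "s \<ge> 1" by (simp add: s_def)
  \<comment> \<open>Since \<open>s \<ge> 1\<close>, \<open>m\<close> is at least \<open>k\<close>;
    its sign is needed to cancel it at the end.\<close>
  have m: "m > 0"
  proof -
    have "int l * s \<ge> int l * 1" using s by (intro mult_left_mono) auto
    then show ?thesis using k_pos by (simp add: m_def)
  qed
  have par: "int k * (int k - 1) = int l * (v - 1)"
    using parameter_equation S by (auto simp: v_def)
  have 1: "(\<Sum>C\<in>B - T. deg S C) = int k * s"
    using sum_deg_restrict[OF T free, of S "deg S"] sum_deg[OF S(1)] by (simp add: s_def)
  have "(\<Sum>C\<in>B - T. deg S C * deg S C) = (\<Sum>C\<in>B. deg S C * deg S C)"
    using sum_deg_restrict[OF T free, of S "\<lambda>C. deg S C * deg S C"] by simp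
  then have 2: "(\<Sum>C\<in>B - T. deg S C * deg S C) = m * s"
    using sum_deg_mult[OF S(1) S(1)] by (simp add: s_def m_def algebra_simps)
  have 3: "int (card (B - T)) = v - t"
    using T finite_blocks card_blocks card_mono[OF finite_blocks T]
    by (simp add: card_Diff_subset finite_subset v_def t_def of_nat_diff)
  have "0 \<le> (\<Sum>C\<in>B - T. (int k * deg S C - m)\<^sup>2)" by (simp add: sum_nonneg)
  also have "\<dots> = int k * int k * (\<Sum>C\<in>B - T. deg S C * deg S C)
      - 2 * int k * m * (\<Sum>C\<in>B - T. deg S C) + m * m * int (card (B - T))"
    by (simp add: power2_eq_square algebra_simps sum.distrib sum_subtractf sum_distrib_left)
  also have "\<dots> = m * (m * (v - t) - int k * int k * s)"
    unfolding 1 2 3 by algebra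
  also have "m * (v - t) - int k * int k * s = (int k - int l) * (v - s - t) - int l * s * t"
    unfolding m_def using par by algebra
  finally have "0 \<le> (int k - int l) * (v - s - t) - int l * s * t"
    using m by (simp add: zero_le_mult_iff)
  then show ?thesis by (simp add: s_def t_def v_def)
qed

text \<open>A block joining a point of \<open>S\<close> to a point of \<open>X\<close> avoids both \<open>Y\<close> and \<open>T\<close>, and there
  are only \<open>card P - card Y - card T\<close> blocks that do.\<close>

lemma joining_blocks_bound:
  assumes S: "S \<subseteq> P" and X: "X \<subseteq> P" and SX: "S \<inter> X = {}"
    and Y: "Y \<subseteq> B" and T: "T \<subseteq> B" and YT: "Y \<inter> T = {}"
    and freeX: "\<And>p C. \<lbrakk>p \<in> X; C \<in> Y\<rbrakk> \<Longrightarrow> \<not> I p C"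
    and freeS: "\<And>p C. \<lbrakk>p \<in> S; C \<in> T\<rbrakk> \<Longrightarrow> \<not> I p C"
    and bound: "\<And>C. C \<in> B \<Longrightarrow> c * (deg X C * deg S C) \<le> b"
  shows "c * (int l * int (card X) * int (card S))
    \<le> (int (card P) - int (card Y) - int (card T)) * b"
proof -
  let ?W = "B - (Y \<union> T)"
  have "int l * int (card X) * int (card S) = (\<Sum>C\<in>B. deg X C * deg S C)"
    using sum_deg_mult[OF X S] SX by (simp add: Int_commute)
  also have "\<dots> = (\<Sum>C\<in>?W. deg X C * deg S C)"
    using finite_blocks freeX freeS
    by (intro sum.mono_neutral_right) (auto simp: deg_def)
  finally have "c * (int l * int (card X) * int (card S)) = (\<Sum>C\<in>?W. c * (deg X C * deg S C))"
    by (simp add: sum_distrib_left)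
  also have "\<dots> \<le> (\<Sum>C\<in>?W. b)" by (intro sum_mono bound) auto
  also have "\<dots> = int (card ?W) * b" by simp
  also have "int (card ?W) = int (card P) - int (card Y) - int (card T)"
  proof -
    have fin: "finite Y" "finite T" using Y T finite_blocks finite_subset by blast+
    have "card (Y \<union> T) = card Y + card T" using fin YT by (rule card_Un_disjoint)
    moreover have "card (Y \<union> T) \<le> card B" using Y T finite_blocks by (intro card_mono) auto
    moreover have "card ?W = card B - card (Y \<union> T)" using Y T fin by (intro card_Diff_subset) auto
    ultimately show ?thesis using card_blocks by simp
  qed
  finally show ?thesis .
qed

text \<open>A block with \<open>d\<close> points in \<open>S\<close> covers at most
  \<open>d (k - d)\<close> pairs, which increases in \<open>d\<close> up to \<open>k / 2\<close>.
  With \<open>s = card S\<close>, at most \<open>s - 1\<close> blocks join \<open>S\<close> to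
  \<open>X\<close>, and a factor \<open>s\<close> cancels.\<close>

lemma joining_blocks_small:
  assumes S: "S \<subseteq> P" "S \<noteq> {}" and X: "X \<subseteq> P" and SX: "S \<inter> X = {}"
    and Y: "Y \<subseteq> B" and T: "T \<subseteq> B" and YT: "Y \<inter> T = {}"
    and freeX: "\<And>p C. \<lbrakk>p \<in> X; C \<in> Y\<rbrakk> \<Longrightarrow> \<not> I p C"
    and freeS: "\<And>p C. \<lbrakk>p \<in> S; C \<in> T\<rbrakk> \<Longrightarrow> \<not> I p C"
    and large: "card P < card S + card Y + card T" and small: "2 * card S \<le> k"
  shows "int l * int (card X) \<le> (int (card S) - 1) * (int k - int (card S))"
proof -
  define s where "s = int (card S)"
  have "card S > 0" using S finite_points by (meson card_gt_0_iff finite_subset)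
  then have s: "s \<ge> 1" by (simp add: s_def)
  have ks: "2 * s \<le> int k" using small by (simp add: s_def)
  have "deg X C * deg S C \<le> s * (int k - s)" if C: "C \<in> B" for C
  proof -
    have "deg X C * deg S C \<le> (int k - deg S C) * deg S C"
      using deg_disjoint_le[OF S(1) X SX C] deg_nonneg[of S C] by (intro mult_right_mono) auto
    \<comment> \<open>The product equals \<open>s (k - s) - d (k - d)\<close> with
      \<open>d = deg S C\<close>.\<close>
    moreover have "0 \<le> (s - deg S C) * (int k - s - deg S C)"
      using deg_le_card[of S C] ks by (intro mult_nonneg_nonneg) (auto simp: s_def)
    ultimately show ?thesis by (simp add: algebra_simps)
  qed
  then have "int l * int (card X) * s
      \<le> (int (card P) - int (card Y) - int (card T)) * (s * (int k - s))"
    using joining_blocks_bound[OF S(1) X SX Y T YT freeX freeS, of 1 "s * (int k - s)"]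
    by (simp add: s_def)
  also have "\<dots> \<le> (s - 1) * (s * (int k - s))"
    using large s ks by (intro mult_right_mono) (auto simp: s_def)
  finally have "s * (int l * int (card X)) \<le> s * ((s - 1) * (int k - s))"
    by (simp add: algebra_simps)
  then show ?thesis using s by (simp add: s_def)
qed

text \<open>By the arithmetic-geometric mean inequality a block covers at most
  \<open>k^2 / 4\<close> pairs; the multiplier \<open>c = 4\<close> avoids the fraction. The number
  of joining blocks is relaxed from \<open>s - 1\<close> to \<open>s\<close>.\<close>

lemma joining_blocks_quarter:
  assumes S: "S \<subseteq> P" "S \<noteq> {}" and X: "X \<subseteq> P" and SX: "S \<inter> X = {}"
    and Y: "Y \<subseteq> B" and T: "T \<subseteq> B" and YT: "Y \<inter> T = {}"
    and freeX: "\<And>p C. \<lbrakk>p \<in> X; C \<in> Y\<rbrakk> \<Longrightarrow> \<not> I p C"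
    and freeS: "\<And>p C. \<lbrakk>p \<in> S; C \<in> T\<rbrakk> \<Longrightarrow> \<not> I p C"
    and large: "card P < card S + card Y + card T"
  shows "4 * (int l * int (card X)) \<le> int k * int k"
proof -
  define s where "s = int (card S)"
  have "card S > 0" using S finite_points by (meson card_gt_0_iff finite_subset)
  then have s: "s \<ge> 1" by (simp add: s_def)
  have "4 * (deg X C * deg S C) \<le> int k * int k" if C: "C \<in> B" for C
  proof -
    have "4 * (deg X C * deg S C) \<le> (deg X C + deg S C) * (deg X C + deg S C)"
      using zero_le_square[of "deg X C - deg S C"] by (simp add: algebra_simps)
    also have "\<dots> \<le> int k * int k"
      using deg_disjoint_le[OF S(1) X SX C] deg_nonneg[of S C] deg_nonneg[of X C]
      by (intro mult_mono) auto
    finally show ?thesis .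
  qed
  then have "4 * (int l * int (card X) * s)
      \<le> (int (card P) - int (card Y) - int (card T)) * (int k * int k)"
    using joining_blocks_bound[OF S(1) X SX Y T YT freeX freeS, of 4 "int k * int k"]
    by (simp add: s_def)
  also have "\<dots> \<le> s * (int k * int k)"
    using large by (intro mult_right_mono) (auto simp: s_def)
  finally have "s * (4 * (int l * int (card X))) \<le> s * (int k * int k)"
    by (simp add: algebra_simps)
  then show ?thesis using s by (simp add: s_def)
qed

end

section \<open>The numerical contradiction\<close>

text \<open>In both lemmas the hypotheses are contradictory: they force a polynomial that is concave
  in \<open>l\<close>, and positive at \<open>l = 1\<close> and \<open>l = k\<close>, to be nonpositive.\<close>

lemma contradiction_small:
  fixes k l s t x v :: int
  assumes l: "1 \<le> l" "l \<le> k" and s: "1 \<le> s" "2 * s \<le> k"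
    and par: "k * (k - 1) = l * (v - 1)" and large: "v + 1 \<le> s + t + x"
    and bound: "l * s * t \<le> (k - l) * (v - s - t)"
    and joins: "l * x \<le> (s - 1) * (k - s)"
  shows False
proof -
  \<comment> \<open>\<open>D l\<close> is a lower bound for \<open>l\<close> times the left minus
    the right side of \<open>bound\<close>, obtained by eliminating \<open>t\<close> with
    \<open>large\<close>, \<open>l v\<close> with \<open>par\<close> and \<open>l x\<close> with
    \<open>joins\<close>.\<close>
  define D where "D j = j * (s * (k * (k - 1)) - (s - 1)^2 * (k - s) + k)
    - j^2 * (s - 1)^2 - (s - 1) * (k - s) * k" for j
  have "l * s * (v + 1 - x - s) \<le> l * s * t"
    using large l s by (intro mult_left_mono) auto
  also have "\<dots> \<le> (k - l) * (x - 1)"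
    using bound mult_left_mono[of "v - s - t" "x - 1" "k - l"] large l by linarith
  finally have "l * (l * s * (v + 1 - x - s)) \<le> l * ((k - l) * (x - 1))"
    using l by (intro mult_left_mono) auto
  moreover have "l * (l * s * (v + 1 - x - s)) - l * ((k - l) * (x - 1))
      = l * s * (k * (k - 1) + 2 * l - l * s) + (k - l) * l - (l * x) * (k - l + l * s)"
    using par by algebra
  moreover have "(l * x) * (k - l + l * s) \<le> ((s - 1) * (k - s)) * (k - l + l * s)"
    using joins l s by (intro mult_right_mono) auto
  moreover have "l * s * (k * (k - 1) + 2 * l - l * s) + (k - l) * l
      - ((s - 1) * (k - s)) * (k - l + l * s) = D l"
    unfolding D_def by algebra
  ultimately have "D l \<le> 0" by linarith
  have "D 1 = k^2 + (s - 1)^3"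
    by (simp add: D_def power2_eq_square power3_eq_cube algebra_simps)
  then have D1: "D 1 > 0" using l s by (simp add: add_pos_nonneg)
  \<comment> \<open>This absorbs the only negative term in the cofactor of \<open>k\<close> in
    \<open>D k\<close>.\<close>
  have "(s - 1) * k * (2 * s - 1) \<le> s * k * (k - 1)"
    using l s by (intro mult_mono) auto
  moreover have "0 \<le> s * s * (s - 1)" using s by simp
  ultimately have "0 < s * k * (k - 1) + k + s * s * (s - 1) - (s - 1) * k * (2 * s - 1)"
    using l by linarith
  moreover have "D k = k * (s * k * (k - 1) + k + s * s * (s - 1) - (s - 1) * k * (2 * s - 1))"
    unfolding D_def by algebra
  ultimately have Dk: "D k > 0" using l by (metis mult_pos_pos order_less_le_trans order_trans zero_less_one)
  \<comment> \<open>A quadratic with leading coefficient \<open>-(s - 1)^2\<close> is its chord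
    through \<open>1\<close> and \<open>k\<close> plus \<open>(s - 1)^2 (l - 1) (k - l)\<close>; the
    factor \<open>k - 1\<close> clears the denominator of the chord.\<close>
  have "(k - 1) * D l = (k - l) * D 1 + (l - 1) * D k + (s - 1)^2 * (k - 1) * (l - 1) * (k - l)"
    by (simp add: D_def power2_eq_square algebra_simps)
  moreover have "0 \<le> (s - 1)^2 * (k - 1) * (l - 1) * (k - l)" using l by simp
  moreover have "0 < (k - l) * D 1 + (l - 1) * D k"
  proof (cases "l = 1")
    case True
    then show ?thesis using D1 s by simp
  next
    case False
    then show ?thesis using D1 Dk l by (intro add_nonneg_pos) auto
  qed
  ultimately have "0 < (k - 1) * D l" by linarith
  then show False using \<open>D l \<le> 0\<close> l by (simp add: zero_less_mult_iff)
qed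

lemma contradiction_large:
  fixes k l s t x v :: int
  assumes l: "1 \<le> l" "l \<le> k" and st: "k \<le> 2 * s" "k \<le> 2 * t"
    and par: "k * (k - 1) = l * (v - 1)" and large: "v + 1 \<le> s + t + x"
    and bound: "l * s * t \<le> (k - l) * (v - s - t)"
    and joins: "4 * (l * x) \<le> k * k"
  shows False
proof -
  \<comment> \<open>\<open>E l\<close> arises from \<open>8 l\<close> times \<open>bound\<close> by
    the same eliminations, after \<open>4 s t\<close> is replaced by
    \<open>2 k (s + t) - k^2\<close>.\<close>
  define E where "E j = j * (3 * k^3 - 4 * k^2 + 8 * j * k - 2 * j * k^2) + 8 * (k - j) * j
    - 2 * (k - j) * k^2" for j
  \<comment> \<open>Bounds \<open>s t\<close> from below in terms of \<open>s + t\<close>, the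
    quantity that \<open>large\<close> controls.\<close>
  have "0 \<le> (2 * s - k) * (2 * t - k)" using st by (intro mult_nonneg_nonneg) auto
  then have "2 * k * (s + t) - k * k \<le> 4 * (s * t)" by (simp add: algebra_simps)
  moreover have "2 * k * (v + 1 - x) \<le> 2 * k * (s + t)"
    using large l by (intro mult_left_mono) auto
  ultimately have "2 * k * (v + 1 - x) - k * k \<le> 4 * (s * t)" by linarith
  then have "l * (2 * k * (v + 1 - x) - k * k) \<le> l * (4 * (s * t))"
    using l by (intro mult_left_mono) auto
  also have "\<dots> = 4 * (l * s * t)" by simp
  also have "\<dots> \<le> 4 * ((k - l) * (x - 1))"
    using bound mult_left_mono[of "v - s - t" "x - 1" "k - l"] large l by linarith
  finally have "2 * l * (l * (2 * k * (v + 1 - x) - k * k)) \<le> 2 * l * (4 * ((k - l) * (x - 1)))"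
    using l by (intro mult_left_mono) auto
  moreover have "2 * l * (l * (2 * k * (v + 1 - x) - k * k)) - 2 * l * (4 * ((k - l) * (x - 1)))
      = 2 * l * (2 * k * (k * (k - 1) + 2 * l) - l * k^2) + 8 * (k - l) * l
        - (4 * (l * x)) * (l * k + 2 * (k - l))"
    using par by algebra
  moreover have "(4 * (l * x)) * (l * k + 2 * (k - l)) \<le> (k * k) * (l * k + 2 * (k - l))"
    using joins l by (intro mult_right_mono) auto
  moreover have "2 * l * (2 * k * (k * (k - 1) + 2 * l) - l * k^2) + 8 * (k - l) * l
        - (k * k) * (l * k + 2 * (k - l)) = E l"
    unfolding E_def by algebra
  ultimately have "E l \<le> 0" by linarith
  have "E 1 = k * (k - 2)^2 + (8 * (k - 1) + 4 * k)"
    unfolding E_def by algebra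
  moreover have "0 < k * (k - 2)^2 + (8 * (k - 1) + 4 * k)"
    using l by (intro add_nonneg_pos) auto
  ultimately have E1: "E 1 > 0" by simp
  have "E k = k^4 + 4 * k^3" unfolding E_def by algebra
  then have Ek: "E k > 0" using l by (simp add: add_pos_nonneg)
  have "(k - 1) * E l = (k - l) * E 1 + (l - 1) * E k + 2 * (k - 2)^2 * (k - 1) * (l - 1) * (k - l)"
    unfolding E_def by algebra
  moreover have "0 \<le> 2 * (k - 2)^2 * (k - 1) * (l - 1) * (k - l)" using l by simp
  moreover have "0 < (k - l) * E 1 + (l - 1) * E k" if "k \<noteq> 1"
  proof (cases "l = 1")
    case True
    then show ?thesis using E1 l that by simp
  next
    case False
    then show ?thesis using E1 Ek l by (intro add_nonneg_pos) auto
  qed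
  ultimately have "0 < (k - 1) * E l" if "k \<noteq> 1" using that by linarith
  \<comment> \<open>For \<open>k = 1\<close> the factor \<open>k - 1\<close> vanishes, but then
    \<open>l = 1\<close> and \<open>E 1 > 0\<close> applies directly.\<close>
  then have "0 < E l" using l E1 by (cases "k = 1") (auto simp: zero_less_mult_iff)
  then show False using \<open>E l \<le> 0\<close> by simp
qed

section \<open>Hall's condition and the bijection\<close>

context symmetric_incidence
begin

text \<open>Hall's condition in a form symmetric in points and blocks, with \<open>T\<close>
  standing for the blocks outside \<open>Y\<close> that miss \<open>S\<close>. By this symmetry the
  case \<open>2 * card T \<le> k\<close> is the dual of \<open>2 * card S \<le> k\<close>.\<close>

lemma two_incidence_free_pairs:
  assumes S: "S \<subseteq> P" and X: "X \<subseteq> P" and SX: "S \<inter> X = {}"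
    and Y: "Y \<subseteq> B" and T: "T \<subseteq> B" and YT: "Y \<inter> T = {}" and XY: "card X = card Y"
    and freeX: "\<And>p C. \<lbrakk>p \<in> X; C \<in> Y\<rbrakk> \<Longrightarrow> \<not> I p C"
    and freeS: "\<And>p C. \<lbrakk>p \<in> S; C \<in> T\<rbrakk> \<Longrightarrow> \<not> I p C"
  shows "card S + card T + card X \<le> card P"
proof (rule ccontr)
  assume "\<not> ?thesis"
  then have large: "card P < card S + card T + card X" by simp
  interpret dual: symmetric_incidence B P "\<lambda>C p. I p C" k l by (rule dual)
  have fin: "finite S" "finite X" "finite Y" "finite T"
    using S X Y T finite_points finite_blocks finite_subset by blast+
  have "card S + card X \<le> card P"
    using S X SX fin finite_points by (metis Un_least card_Un_disjoint card_mono)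
  then have T0: "T \<noteq> {}" using large by auto
  have "card T + card Y \<le> card P"
    using T Y YT fin finite_blocks card_blocks
    by (metis Un_least card_Un_disjoint card_mono Int_commute)
  then have S0: "S \<noteq> {}" using large XY by auto
  have "card S + card T \<le> card P" using incidence_free_card_le[OF S T freeS] .
  then obtain p where p: "p \<in> X" using large fin by (cases "X = {}") auto
  obtain q where q: "q \<in> S" using S0 by blast
  \<comment> \<open>Two distinct points are needed for \<open>l \<le> k\<close>: on a single point
    \<open>l\<close> is unconstrained.\<close>
  have "card {C \<in> B. I p C \<and> I q C} \<le> card {C \<in> B. I p C}"
    using finite_blocks by (intro card_mono) auto
  moreover have "p \<noteq> q" using p q SX by auto
  ultimately have lk: "l \<le> k"
    using pair_degree[of p q] dual.block_size[of p] p q S X by auto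
  have par: "int k * (int k - 1) = int l * (int (card P) - 1)"
    using parameter_equation q S by auto
  have bound: "int l * int (card S) * int (card T)
      \<le> (int k - int l) * (int (card P) - int (card S) - int (card T))"
    using incidence_free_bound[OF S S0 T freeS] .
  have l: "1 \<le> int l" "int l \<le> int k" using lk l_pos by auto
  have st: "1 \<le> int (card S)" "1 \<le> int (card T)"
    using S0 T0 fin by (auto simp: Suc_le_eq card_gt_0_iff)
  consider "2 * card S \<le> k" | "2 * card T \<le> k" | "k < 2 * card S" "k < 2 * card T" by linarith
  then show False
  proof cases
    case 1
    then have "int l * int (card X) \<le> (int (card S) - 1) * (int k - int (card S))"
      using joining_blocks_small[OF S S0 X SX Y T YT freeX freeS] large XY by simp
    then show False
      using contradiction_small[OF l st(1) _ par _ bound, of "int (card X)"] 1 large by simp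
  next
    case 2
    have "int l * int (card Y) \<le> (int (card T) - 1) * (int k - int (card T))"
      using dual.joining_blocks_small[OF T T0 Y _ X S] SX YT freeX freeS large XY card_blocks 2
      by (simp add: Int_commute)
    moreover have "int l * int (card T) * int (card S)
      \<le> (int k - int l) * (int (card P) - int (card T) - int (card S))"
      using bound by (simp add: algebra_simps)
    ultimately show False
      using contradiction_small[OF l st(2) _ par, of "int (card S)" "int (card X)"] 2 large XY by simp
  next
    case 3
    have "4 * (int l * int (card X)) \<le> int k * int k"
      using joining_blocks_quarter[OF S S0 X SX Y T YT freeX freeS] large XY by simp
    then show False
      using contradiction_large[OF l _ _ par _ bound, of "int (card X)"] 3 large by simp
  qed
qed

text \<open>Taking for \<open>T\<close> all blocks outside \<open>Y\<close> that miss
  \<open>S\<close> turns the preceding bound into Hall's inequality for \<open>S\<close>. The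
  resulting injection is onto because both complements have the same size.\<close>

lemma complement_bijection:
  assumes X: "X \<subseteq> P" and Y: "Y \<subseteq> B" and XY: "card X = card Y"
    and free: "\<And>p C. \<lbrakk>p \<in> X; C \<in> Y\<rbrakk> \<Longrightarrow> \<not> I p C"
  obtains f where "bij_betw f (P - X) (B - Y)" "\<And>p. p \<in> P - X \<Longrightarrow> I p (f p)"
proof -
  have fin: "finite X" "finite Y" using X Y finite_points finite_blocks finite_subset by blast+
  have "\<exists>f. inj_on f (P - X) \<and> (\<forall>p\<in>P - X. f p \<in> {C \<in> B - Y. I p C})"
  proof (rule hall_marriage)
    fix S assume S: "S \<subseteq> P - X"
    define T where "T = B - Y - (\<Union>p\<in>S. {C \<in> B - Y. I p C})"
    let ?N = "\<Union>p\<in>S. {C \<in> B - Y. I p C}"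
    have "card S + card T + card X \<le> card P"
      by (rule two_incidence_free_pairs[where Y = Y]) (use S X Y XY free in \<open>auto simp: T_def\<close>)
    moreover have "card T = card (B - Y) - card ?N"
      unfolding T_def using finite_blocks by (intro card_Diff_subset) (auto intro: finite_subset[of _ B])
    moreover have "card (B - Y) = card P - card X"
      using Y fin XY card_blocks by (simp add: card_Diff_subset)
    moreover have "card ?N \<le> card (B - Y)" using finite_blocks by (intro card_mono) auto
    ultimately show "card S \<le> card ?N" by linarith
  qed (use finite_points finite_blocks in auto)
  then obtain f where f: "inj_on f (P - X)" "\<And>p. p \<in> P - X \<Longrightarrow> f p \<in> {C \<in> B - Y. I p C}"
    by blast
  have "card (P - X) = card (B - Y)"
    using X Y fin XY card_blocks by (simp add: card_Diff_subset)
  then have "f ` (P - X) = B - Y"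
    using f finite_blocks by (intro card_subset_eq) (auto simp: card_image)
  then show ?thesis using that f by (auto simp: bij_betw_def)
qed

end

section \<open>Passage to the incidence graph\<close>

lemma perfect_matching_incidence_graph:
  assumes \<sigma>: "bij_betw \<sigma> (P - X) (B - Y)" and inc: "\<And>p. p \<in> P - X \<Longrightarrow> p \<in> \<sigma> p"
  shows "perfect_matching (induced_subgraph (incidence_graph P B) ((P - X) <+> (B - Y)))
    ((\<lambda>p. {Inl p, Inr (\<sigma> p)}) ` (P - X))"
proof -
  let ?e = "\<lambda>p. {Inl p, Inr (\<sigma> p)}"
  have img: "\<sigma> p \<in> B - Y" if "p \<in> P - X" for p
    using \<sigma> that by (auto simp: bij_betw_def)
  have inj: "p = q" if "p \<in> P - X" "q \<in> P - X" "\<sigma> p = \<sigma> q" for p q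
    using \<sigma> that by (auto simp: bij_betw_def inj_on_def)
  have surj: "\<exists>p\<in>P - X. C = \<sigma> p" if "C \<in> B - Y" for C
    using \<sigma> that by (auto simp: bij_betw_def)
  have unique: "\<exists>!e. e \<in> ?e ` (P - X) \<and> z \<in> e" if "z \<in> (P - X) <+> (B - Y)" for z
    using that
  proof
    fix p assume "p \<in> P - X" "z = Inl p"
    then show ?thesis by (intro ex1I[of _ "?e p"]) auto
  next
    fix C assume C: "C \<in> B - Y" "z = Inr C"
    then obtain p where "p \<in> P - X" "C = \<sigma> p" using surj by blast
    then show ?thesis using C inj by (intro ex1I[of _ "?e p"]) auto
  qed
  show ?thesis
    unfolding perfect_matching_def induced_subgraph_def incidence_graph_def
    using inc img unique by auto
qed

theorem theorem1:
  fixes P :: "'a set" and B :: "'a set set" and v k l :: nat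
    and X :: "'a set" and Y :: "'a set set"
  assumes "symmetric_design P B v k l"
    and "X \<subseteq> P" and "Y \<subseteq> B"
    and "equinumerous X Y" and "incidence_free X Y"
  shows "(\<exists>M. perfect_matching (induced_subgraph (incidence_graph P B) ((P - X) <+> (B - Y))) M)
    \<and> (\<exists>\<sigma>. bij_betw \<sigma> (P - X) (B - Y) \<and> (\<forall>p\<in>P - X. p \<in> \<sigma> p))"
proof -
  have D: "0 < k" "0 < l" "finite P" "card P = v" "B \<subseteq> Pow P" "card B = v"
    "\<And>C. C \<in> B \<Longrightarrow> card C = k"
    "\<And>p q. \<lbrakk>p \<in> P; q \<in> P; p \<noteq> q\<rbrakk> \<Longrightarrow> card {C \<in> B. p \<in> C \<and> q \<in> C} = l"
    using assms(1) by (auto simp: symmetric_design_def)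
  interpret symmetric_incidence P B "(\<in>)" k l
  proof
    show "finite B" using D by (meson finite_Pow_iff finite_subset)
    fix C assume C: "C \<in> B"
    then have "{p \<in> P. p \<in> C} = C" using D by auto
    then show "card {p \<in> P. p \<in> C} = k" using C D by simp
  qed (use D in auto)
  obtain \<sigma> where "bij_betw \<sigma> (P - X) (B - Y)" "\<And>p. p \<in> P - X \<Longrightarrow> p \<in> \<sigma> p"
    using complement_bijection[of X Y] assms
    by (auto simp: equinumerous_def incidence_free_def)
  then show ?thesis
    using perfect_matching_incidence_graph by blast
qed

end
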